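(* For all integers $n\geq 2$, we have $$|S_n^{(2)}(213:132)|=(n+2)\cdot 2^{n-3}.$$
   Context: $S_n$ denotes the set of permutations $p=p(1)p(2)\cdots p(n)$ of $\{1,2,\ldots,n\}$ in one-line notation. For $p\in S_n$ and $q\in S_m$, $p$ contains $q$ as a pattern if there exist $1\leq i_1<\cdots<i_m\leq n$ such that for all $1\leq a<b\leq m$, $p(i_a)<p(i_b)$ if and only if $q(a)<q(b)$; otherwise $p$ avoids $q$. For $p\in S_n$ with $n\geq 2$, $p^{(2)}=p(2)p(3)\cdots p(n)p(1)$. For $q_1,q_2\in S_3$, $S_n^{(2)}(q_1:q_2)$ is the set of $p\in S_n$ such that $p$ avoids $q_1$ and $p^{(2)}$ avoids $q_2$. *)

theory Defs
  imports Complex_Main "HOL-Combinatorics.Multiset_Permutations"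
begin

text \<open>
  A permutation \<open>p\<close> of \<open>{1..n}\<close> is represented by its one-line notation \<open>p(1) p(2) ... p(n)\<close>,
  that is, by an element of \<^term>\<open>permutations_of_set {1..n::nat}\<close>. As list positions count
  from 0, the entry \<open>p(i)\<close> is \<open>p ! (i - 1)\<close>, and the indices \<open>1 \<le> i\<^sub>1 < ... < i\<^sub>m \<le> n\<close> of an
  occurrence of a pattern become a strictly increasing map from \<open>{..<m}\<close> to \<open>{..<n}\<close>.
\<close>

definition contains_pattern :: "nat list \<Rightarrow> nat list \<Rightarrow> bool" where
  "contains_pattern p q \<longleftrightarrow>
     (\<exists>i :: nat \<Rightarrow> nat.
        strict_mono_on {..<length q} i \<and>
        i ` {..<length q} \<subseteq> {..<length p} \<and>
        (\<forall>a b. a < b \<and> b < length q \<longrightarrow> (p ! i a < p ! i b \<longleftrightarrow> q ! a < q ! b)))"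

abbreviation avoids_pattern :: "nat list \<Rightarrow> nat list \<Rightarrow> bool" where
  "avoids_pattern p q \<equiv> \<not> contains_pattern p q"

text \<open>
  The rotation \<open>p^(2) = p(2) p(3) ... p(n) p(1)\<close> is \<^term>\<open>rotate1 p\<close>.
\<close>

definition avoiders2 :: "nat \<Rightarrow> nat list \<Rightarrow> nat list \<Rightarrow> nat list set" where
  "avoiders2 n q1 q2 =
     {p \<in> permutations_of_set {1..n}. avoids_pattern p q1 \<and> avoids_pattern (rotate1 p) q2}"

end

theory Submission
  imports Defs
begin

text \<open>
  Let \<open>p = a w\<close> with first entry \<open>a\<close>. An occurrence of 213 in \<open>p\<close> that uses the first entry and
  an occurrence of 132 in \<open>w a\<close> that uses the last entry are the same thing: an entry of \<open>w\<close>
  below \<open>a\<close> followed by one above \<open>a\<close>. Hence \<open>p\<close> is counted iff \<open>w = L S\<close> with \<open>L > a > S\<close>, where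
  \<open>L\<close> and \<open>S\<close> avoid both 132 and 213 independently. Lists that avoid both patterns decompose in
  the same way after their first entry, with \<open>L\<close> increasing in addition; this gives \<open>2^(k-1)\<close>
  of them for every length \<open>k \<ge> 1\<close>, and the product is summed over \<open>a\<close>.
\<close>

text \<open>Otherwise the simplifier would rewrite the entry 1 of the patterns to \<open>Suc 0\<close>.\<close>

declare One_nat_def [simp del]

section \<open>Occurrences of patterns of length three\<close>

lemma contains_pattern_3:
  "contains_pattern p [u, v, w] \<longleftrightarrow>
     (\<exists>i j k. i < j \<and> j < k \<and> k < length p \<and> (p ! i < p ! j \<longleftrightarrow> u < v) \<and>
        (p ! i < p ! k \<longleftrightarrow> u < w) \<and> (p ! j < p ! k \<longleftrightarrow> v < w))"
  (is "_ \<longleftrightarrow> (\<exists>i j k. ?occ i j k)")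
proof
  assume "contains_pattern p [u, v, w]"
  then obtain f where f: "strict_mono_on {..<3} f" "f ` {..<3} \<subseteq> {..<length p}"
    and o: "\<And>a b. a < b \<Longrightarrow> b < 3 \<Longrightarrow> p ! f a < p ! f b \<longleftrightarrow> [u, v, w] ! a < [u, v, w] ! b"
    unfolding contains_pattern_def by (auto simp: numeral_3_eq_3)
  have "f 0 < f 1" "f 1 < f 2" "f 2 < length p"
    using f by (auto simp: strict_mono_on_def image_subset_iff)
  then have "?occ (f 0) (f 1) (f 2)"
    using o[of 0 1] o[of 0 2] o[of 1 2] by simp
  then show "\<exists>i j k. ?occ i j k" by blast
next
  assume "\<exists>i j k. ?occ i j k"
  then obtain i j k where occ: "?occ i j k" by blast
  have cases: "P a b" if "a < b" "b < 3" "P 0 1" "P 0 2" "P 1 2" for a b :: nat and P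
  proof -
    have "a = 0 \<and> b = 1 \<or> a = 0 \<and> b = 2 \<or> a = 1 \<and> b = 2" using that(1,2) by linarith
    then show ?thesis using that by auto
  qed
  show "contains_pattern p [u, v, w]"
    unfolding contains_pattern_def
  proof (intro exI[of _ "\<lambda>x. if x = 0 then i else if x = 1 then j else k"] conjI allI impI)
    show "strict_mono_on {..<length [u, v, w]} (\<lambda>x. if x = 0 then i else if x = 1 then j else k)"
      using occ by (auto simp: strict_mono_on_def)
  next
    show "(\<lambda>x. if x = 0 then i else if x = 1 then j else k) ` {..<length [u, v, w]} \<subseteq> {..<length p}"
      using occ by auto
  next
    fix a b :: nat
    assume "a < b \<and> b < length [u, v, w]"
    then have "a < b" "b < 3" by simp_all
    then show "(p ! (if a = 0 then i else if a = 1 then j else k)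
        < p ! (if b = 0 then i else if b = 1 then j else k)) = ([u, v, w] ! a < [u, v, w] ! b)"
      by (rule cases) (use occ in simp_all)
  qed
qed

lemma avoids_pattern_Nil [simp]: "q \<noteq> [] \<Longrightarrow> avoids_pattern [] q"
  by (auto simp: contains_pattern_def)

text \<open>An occurrence in \<open>a # p\<close> either lies within \<open>p\<close> or uses
  \<open>a\<close> as its first entry. In the second case it is completed by an ordered pair of
  entries of \<open>p\<close>, and such pairs are what \<open>sorted_wrt\<close> ranges
  over.\<close>

lemma avoids_pattern_3_Cons:
  "avoids_pattern (a # p) [u, v, w] \<longleftrightarrow> avoids_pattern p [u, v, w] \<and>
     sorted_wrt (\<lambda>y z. \<not> ((a < y \<longleftrightarrow> u < v) \<and> (a < z \<longleftrightarrow> u < w) \<and> (y < z \<longleftrightarrow> v < w))) p"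
  (is "?L \<longleftrightarrow> ?R")
proof
  assume L: ?L
  then have "\<not> (i < j \<and> j < k \<and> k < length (a # p) \<and> ((a # p) ! i < (a # p) ! j \<longleftrightarrow> u < v) \<and>
    ((a # p) ! i < (a # p) ! k \<longleftrightarrow> u < w) \<and> ((a # p) ! j < (a # p) ! k \<longleftrightarrow> v < w))" for i j k
    unfolding contains_pattern_3 by blast
  \<comment> \<open>Triples of positive positions give the occurrences inside \<open>p\<close>;
    triples starting at 0 give those that use \<open>a\<close>.\<close>
  from this[of "Suc _" "Suc _" "Suc _"] this[of 0 "Suc _" "Suc _"]
  show ?R
    unfolding contains_pattern_3 sorted_wrt_iff_nth_less by auto
next
  assume R: ?R
  show ?L
    unfolding contains_pattern_3
  proof clarify
    fix i j k
    assume *: "i < j" "j < k" "k < length (a # p)" "((a # p) ! i < (a # p) ! j) = (u < v)"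
      "((a # p) ! i < (a # p) ! k) = (u < w)" "((a # p) ! j < (a # p) ! k) = (v < w)"
    then obtain j' k' where jk: "j = Suc j'" "k = Suc k'" by (metis not_less0 not0_implies_Suc)
    show False
      using R * unfolding contains_pattern_3 sorted_wrt_iff_nth_less jk by (cases i) auto
  qed
qed

text \<open>The third comparison \<open>y < z\<close> follows from the other two. The weak
  inequality is the negation of \<open>a < y\<close>, since entries may still repeat here.\<close>

lemma avoids_213_Cons:
  "avoids_pattern (a # p) [2, 1, 3] \<longleftrightarrow>
     avoids_pattern p [2, 1, 3] \<and> sorted_wrt (\<lambda>y z. \<not> (y \<le> a \<and> a < z)) p"
proof -
  have "\<not> ((a < y \<longleftrightarrow> (2::nat) < 1) \<and> (a < z \<longleftrightarrow> (2::nat) < 3) \<and> (y < z \<longleftrightarrow> (1::nat) < 3))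
      \<longleftrightarrow> \<not> (y \<le> a \<and> a < z)" for y z by auto
  then show ?thesis by (simp only: avoids_pattern_3_Cons)
qed

lemma avoids_132_Cons:
  "avoids_pattern (a # p) [1, 3, 2] \<longleftrightarrow>
     avoids_pattern p [1, 3, 2] \<and> sorted_wrt (\<lambda>y z. \<not> (a < z \<and> z \<le> y)) p"
proof -
  have "\<not> ((a < y \<longleftrightarrow> (1::nat) < 3) \<and> (a < z \<longleftrightarrow> (1::nat) < 2) \<and> (y < z \<longleftrightarrow> (3::nat) < 2))
      \<longleftrightarrow> \<not> (a < z \<and> z \<le> y)" for y z by auto
  then show ?thesis by (simp only: avoids_pattern_3_Cons)
qed

text \<open>A new occurrence must use the last entry \<open>a\<close> as the 2, with
  \<open>y\<close> as the 1 and \<open>z\<close> as the 3.\<close>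

lemma avoids_132_snoc:
  "avoids_pattern (p @ [a]) [1, 3, 2] \<longleftrightarrow>
     avoids_pattern p [1, 3, 2] \<and> sorted_wrt (\<lambda>y z. \<not> (y < a \<and> a \<le> z)) p"
  by (induction p) (auto simp: avoids_132_Cons sorted_wrt_append)

section \<open>Concatenations with all of the left block above the right block\<close>

lemma sorted_wrt_trivial: "(\<And>x y. x \<in> set xs \<Longrightarrow> y \<in> set xs \<Longrightarrow> P x y) \<Longrightarrow> sorted_wrt P xs"
  by (induction xs) auto

lemma sorted_wrt_set_cong:
  "(\<And>x y. x \<in> set xs \<Longrightarrow> y \<in> set xs \<Longrightarrow> P x y \<longleftrightarrow> Q x y) \<Longrightarrow> sorted_wrt P xs \<longleftrightarrow> sorted_wrt Q xs"
  by (induction xs) auto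

text \<open>An occurrence meeting both blocks would cut the pattern as 1|32 or 13|2 with everything
  left of the cut larger than everything right of it, but the 1 is left of the cut.\<close>

lemma avoids_132_append:
  assumes "\<And>x y. x \<in> set xs \<Longrightarrow> y \<in> set ys \<Longrightarrow> y < x"
  shows "avoids_pattern (xs @ ys) [1, 3, 2] \<longleftrightarrow>
    avoids_pattern xs [1, 3, 2] \<and> avoids_pattern ys [1, 3, 2]"
  using assms
proof (induction xs)
  case (Cons x xs)
  have "sorted_wrt (\<lambda>y z. \<not> (x < z \<and> z \<le> y)) ys"
    by (rule sorted_wrt_trivial) (use Cons.prems[of x] in force)
  moreover have "\<not> (x < z \<and> z \<le> y)" if "z \<in> set ys" for y z
    using Cons.prems[of x z] that by simp
  ultimately show ?case
    using Cons by (auto simp: avoids_132_Cons sorted_wrt_append)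
qed simp

text \<open>The same argument: in both cuts 2|13 and 21|3 the 3 is on the right.\<close>

lemma avoids_213_append:
  assumes "\<And>x y. x \<in> set xs \<Longrightarrow> y \<in> set ys \<Longrightarrow> y < x"
  shows "avoids_pattern (xs @ ys) [2, 1, 3] \<longleftrightarrow>
    avoids_pattern xs [2, 1, 3] \<and> avoids_pattern ys [2, 1, 3]"
  using assms
proof (induction xs)
  case (Cons x xs)
  have "sorted_wrt (\<lambda>y z. \<not> (y \<le> x \<and> x < z)) ys"
    by (rule sorted_wrt_trivial) (use Cons.prems[of x] in force)
  moreover have "\<not> (y \<le> x \<and> x < z)" if "z \<in> set ys" for y z
    using Cons.prems[of x z] that by simp
  ultimately show ?case
    using Cons by (auto simp: avoids_213_Cons sorted_wrt_append)
qed simp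

section \<open>Lists avoiding both 132 and 213\<close>

lemma strict_sorted_avoids:
  assumes "sorted_wrt (<) xs"
  shows "avoids_pattern xs [1, 3, 2]" "avoids_pattern xs [2, 1, 3]"
proof -
  show "avoids_pattern xs [1, 3, 2]"
    using assms by (induction xs) (auto simp: avoids_132_Cons elim!: sorted_wrt_mono_rel[rotated])
  show "avoids_pattern xs [2, 1, 3]"
    using assms by (induction xs) (auto simp: avoids_213_Cons intro!: sorted_wrt_trivial)
qed

text \<open>Arbitrary sets of entries are allowed, so that the blocks of a list can be treated
  without relabelling them to an initial segment.\<close>

definition Av :: "nat set \<Rightarrow> nat list set" where
  "Av A = {w \<in> permutations_of_set A. avoids_pattern w [1, 3, 2] \<and> avoids_pattern w [2, 1, 3]}"

lemma Av_empty [simp]: "Av {} = {[]}"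
  by (auto simp: Av_def)

lemma set_Av: "w \<in> Av A \<Longrightarrow> set w = A"
  by (simp add: Av_def permutations_of_set_def)

abbreviation above_then_below :: "nat \<Rightarrow> nat list \<Rightarrow> bool" where
  "above_then_below a w \<equiv> sorted_wrt (\<lambda>y z. \<not> (y \<le> a \<and> a < z)) w"

text \<open>Once an entry at most \<open>a\<close> has appeared, no later entry exceeds
  \<open>a\<close>, so moving the large entries to the front changes nothing.\<close>

lemma above_then_below_split:
  "above_then_below a w \<Longrightarrow> w = filter (\<lambda>x. a < x) w @ filter (\<lambda>x. x \<le> a) w"
proof (induction w)
  case (Cons x w)
  show ?case
  proof (cases "a < x")
    case False
    then have "\<forall>z\<in>set w. z \<le> a" using Cons.prems by auto
    then show ?thesis using False by (auto simp: filter_empty_conv)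
  qed (use Cons in auto)
qed simp

text \<open>Filtering by comparison with \<open>a\<close> recovers the two blocks, and avoidance of
  both patterns can be checked blockwise because the left block lies above the right one.\<close>

lemma bij_betw_append_Av:
  assumes "a \<in> A"
  shows "bij_betw (\<lambda>(xs, ys). xs @ ys) (Av {x \<in> A. a < x} \<times> Av {x \<in> A. x < a})
    {w \<in> Av (A - {a}). above_then_below a w}"
    (is "bij_betw ?f (?L \<times> ?S) ?W")
  unfolding bij_betw_def
proof
  have filters: "filter (\<lambda>x. a < x) (xs @ ys) = xs" "filter (\<lambda>x. x < a) (xs @ ys) = ys"
    if "xs \<in> ?L" "ys \<in> ?S" for xs ys
    using set_Av[OF that(1)] set_Av[OF that(2)] by (auto simp: filter_empty_conv filter_id_conv)
  show "inj_on ?f (?L \<times> ?S)"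
    by (rule inj_onI) (clarsimp, metis filters)
  show "?f ` (?L \<times> ?S) = ?W"
  proof (intro equalityI subsetI)
    fix w assume "w \<in> ?f ` (?L \<times> ?S)"
    then obtain xs ys where w: "w = xs @ ys" and xs: "xs \<in> ?L" and ys: "ys \<in> ?S" by auto
    note sets = set_Av[OF xs] set_Av[OF ys]
    have less: "y < x" if "x \<in> set xs" "y \<in> set ys" for x y
      using that unfolding sets by auto
    have avoids: "avoids_pattern (xs @ ys) [1, 3, 2]" "avoids_pattern (xs @ ys) [2, 1, 3]"
      using xs ys avoids_132_append less avoids_213_append unfolding Av_def by blast+
    have "set w = A - {a}" using assms unfolding w set_append sets by auto
    moreover have "distinct w"
    proof -
      have "distinct xs" "distinct ys"
        using xs ys by (simp_all add: Av_def permutations_of_set_def)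
      moreover have "set xs \<inter> set ys = {}"
        using less by blast
      ultimately show ?thesis by (simp add: w)
    qed
    moreover have "above_then_below a w"
      unfolding w sorted_wrt_append by (intro conjI sorted_wrt_trivial) (auto simp: sets)
    ultimately show "w \<in> ?W"
      using xs ys avoids unfolding w by (simp add: Av_def permutations_of_set_def)
  next
    fix w assume w: "w \<in> ?W"
    define xs ys where "xs = filter (\<lambda>x. a < x) w" and "ys = filter (\<lambda>x. x \<le> a) w"
    have eq: "w = xs @ ys" using w above_then_below_split unfolding xs_def ys_def by blast
    have set_w: "set w = A - {a}" using w set_Av by blast
    have sets: "set xs = {x \<in> A. a < x}" "set ys = {x \<in> A. x < a}"
      unfolding xs_def ys_def set_filter set_w by auto
    have less: "y < x" if "x \<in> set xs" "y \<in> set ys" for x y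
      using that unfolding xs_def ys_def set_filter set_w by auto
    have avoids: "avoids_pattern (xs @ ys) [1, 3, 2]" "avoids_pattern (xs @ ys) [2, 1, 3]"
      and "distinct (xs @ ys)"
      using w unfolding eq by (auto simp: Av_def permutations_of_set_def)
    from avoids have "avoids_pattern xs [1, 3, 2]" "avoids_pattern xs [2, 1, 3]"
      "avoids_pattern ys [1, 3, 2]" "avoids_pattern ys [2, 1, 3]"
      using avoids_132_append less avoids_213_append by blast+
    with sets \<open>distinct (xs @ ys)\<close> have "xs \<in> ?L" "ys \<in> ?S"
      by (simp_all add: Av_def permutations_of_set_def)
    then show "w \<in> ?f ` (?L \<times> ?S)" unfolding eq by force
  qed
qed

section \<open>Counting by the first entry\<close>

lemma card_permutations_of_set_by_head:
  assumes "finite A" "A \<noteq> {}"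
  shows "card {p \<in> permutations_of_set A. Q p} =
    (\<Sum>a\<in>A. card {w \<in> permutations_of_set (A - {a}). Q (a # w)})"
proof -
  have "{p \<in> permutations_of_set A. Q p} =
      (\<Union>a\<in>A. (#) a ` {w \<in> permutations_of_set (A - {a}). Q (a # w)})"
    using assms(2) by (subst permutations_of_set_nonempty) auto
  also have "card \<dots> = (\<Sum>a\<in>A. card ((#) a ` {w \<in> permutations_of_set (A - {a}). Q (a # w)}))"
    using assms(1) by (intro card_UN_disjoint) auto
  also have "\<dots> = (\<Sum>a\<in>A. card {w \<in> permutations_of_set (A - {a}). Q (a # w)})"
    by (intro sum.cong refl card_image) auto
  finally show ?thesis .
qed

text \<open>With first entry \<open>a\<close>, avoiding 213 puts the entries above \<open>a\<close>
  before those below, and avoiding 132 makes the former increasing. Only the block below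
  \<open>a\<close> remains free.\<close>

lemma card_Av_by_head:
  assumes "finite A" "A \<noteq> {}"
  shows "card (Av A) = (\<Sum>a\<in>A. card (Av {x \<in> A. x < a}))"
proof -
  have "card (Av A) = (\<Sum>a\<in>A. card {w \<in> permutations_of_set (A - {a}).
      avoids_pattern (a # w) [1, 3, 2] \<and> avoids_pattern (a # w) [2, 1, 3]})"
    unfolding Av_def by (rule card_permutations_of_set_by_head[OF assms])
  also have "\<dots> = (\<Sum>a\<in>A. card (Av {x \<in> A. x < a}))"
  proof (intro sum.cong refl)
    fix a assume a: "a \<in> A"
    let ?L = "{x \<in> A. a < x}" and ?S = "{x \<in> A. x < a}"
    let ?xs = "sorted_list_of_set ?L"
    let ?inc = "\<lambda>w. sorted_wrt (\<lambda>y z. \<not> (a < z \<and> z \<le> y)) w"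
    have xs: "?xs \<in> Av ?L"
      using strict_sorted_avoids[of ?xs] assms(1)
      by (simp add: Av_def permutations_of_set_def)
    \<comment> \<open>No entry of \<open>ys\<close> exceeds \<open>a\<close>, so \<open>?inc\<close>
      restricts only \<open>xs\<close>. There every entry exceeds \<open>a\<close>, so the condition
      becomes strict increase.\<close>
    have inc: "?inc (xs @ ys) \<longleftrightarrow> xs = ?xs" if "xs \<in> Av ?L" "ys \<in> Av ?S" for xs ys
    proof -
      note sets = set_Av[OF that(1)] set_Av[OF that(2)]
      have "?inc (xs @ ys) \<longleftrightarrow> ?inc xs"
      proof -
        have "?inc ys" by (rule sorted_wrt_trivial) (auto simp: sets)
        then show ?thesis unfolding sorted_wrt_append by (auto simp: sets)
      qed
      also have "\<dots> \<longleftrightarrow> sorted_wrt (<) xs"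
        by (rule sorted_wrt_set_cong) (auto simp: sets)
      also have "\<dots> \<longleftrightarrow> xs = ?xs"
        using assms(1) unfolding sets(1)[symmetric]
        by (metis sorted_list_of_set.idem_if_sorted_distinct strict_sorted_iff
            sorted_list_of_set.strict_sorted_key_list_of_set)
      finally show ?thesis .
    qed
    have bij: "bij_betw (\<lambda>(xs, ys). xs @ ys) (Av ?L \<times> Av ?S)
        {w \<in> Av (A - {a}). above_then_below a w}"
      by (rule bij_betw_append_Av[OF a])
    have "{w \<in> permutations_of_set (A - {a}).
        avoids_pattern (a # w) [1, 3, 2] \<and> avoids_pattern (a # w) [2, 1, 3]}
      = {w \<in> {w \<in> Av (A - {a}). above_then_below a w}. ?inc w}"
      by (auto simp: Av_def avoids_132_Cons avoids_213_Cons)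
    also have "\<dots> = (@) ?xs ` Av ?S"
      unfolding bij_betw_imp_surj_on[OF bij, symmetric] using inc xs by (auto 0 3)
    also have "card \<dots> = card (Av ?S)"
      by (intro card_image) (auto simp: inj_on_def)
    finally show "card {w \<in> permutations_of_set (A - {a}).
        avoids_pattern (a # w) [1, 3, 2] \<and> avoids_pattern (a # w) [2, 1, 3]} = card (Av ?S)" .
  qed
  finally show ?thesis .
qed

text \<open>Truncated subtraction makes the formula correct for \<open>A = {}\<close> as well.\<close>

lemma card_Av:
  assumes "finite A"
  shows "card (Av A) = 2 ^ (card A - 1)"
  using assms
proof (induction rule: finite_linorder_max_induct)
  case (insert m A)
  show ?case
  proof (cases "A = {}")
    case True
    have "card (Av {m}) = (\<Sum>a\<in>{m}. card (Av {x \<in> {m}. x < a}))"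
      by (rule card_Av_by_head) auto
    also have "\<dots> = card (Av {x \<in> {m}. x < m})" by simp
    also have "{x \<in> {m}. x < m} = {}" by auto
    finally show ?thesis using True by simp
  next
    case False
    have "m \<notin> A" using insert.hyps(2) by blast
    \<comment> \<open>The new maximum \<open>m\<close> contributes \<open>card (Av A)\<close>. The
      other terms do not see \<open>m\<close> and, by the same recursion for \<open>A\<close>, again
      sum to \<open>card (Av A)\<close>; so the count doubles.\<close>
    have "card (Av (insert m A)) = (\<Sum>a\<in>insert m A. card (Av {x \<in> insert m A. x < a}))"
      using insert.hyps(1) by (intro card_Av_by_head) auto
    also have "\<dots> = card (Av {x \<in> insert m A. x < m}) + (\<Sum>a\<in>A. card (Av {x \<in> insert m A. x < a}))"
      using insert.hyps(1) \<open>m \<notin> A\<close> by simp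
    also have "{x \<in> insert m A. x < m} = A"
      using insert.hyps(2) by auto
    also have "(\<Sum>a\<in>A. card (Av {x \<in> insert m A. x < a})) = (\<Sum>a\<in>A. card (Av {x \<in> A. x < a}))"
    proof (rule sum.cong[OF refl])
      fix a assume "a \<in> A"
      then have "{x \<in> insert m A. x < a} = {x \<in> A. x < a}" using insert.hyps(2) by force
      then show "card (Av {x \<in> insert m A. x < a}) = card (Av {x \<in> A. x < a})" by simp
    qed
    also have "\<dots> = card (Av A)"
      using card_Av_by_head[OF insert.hyps(1) False] by simp
    finally have "card (Av (insert m A)) = 2 * 2 ^ (card A - 1)"
      using insert.IH by simp
    moreover have "card A > 0" using False insert.hyps(1) by (simp add: card_gt_0_iff)
    ultimately show ?thesis
      using insert.hyps(1) \<open>m \<notin> A\<close> by (simp flip: power_Suc)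
  qed
qed simp

text \<open>The blocks above and below the first entry \<open>a\<close> have \<open>n - a\<close>
  and \<open>a - 1\<close> entries. Truncated subtraction gives an empty block the factor 1.\<close>

lemma card_avoiders2:
  assumes "n \<ge> 1"
  shows "card (avoiders2 n [2, 1, 3] [1, 3, 2]) = (\<Sum>a=1..n. 2 ^ (n - a - 1) * 2 ^ (a - 2))"
proof -
  have "card (avoiders2 n [2, 1, 3] [1, 3, 2]) = (\<Sum>a=1..n. card {w \<in> permutations_of_set ({1..n} - {a}).
      avoids_pattern (a # w) [2, 1, 3] \<and> avoids_pattern (rotate1 (a # w)) [1, 3, 2]})"
    unfolding avoiders2_def by (rule card_permutations_of_set_by_head) (use assms in auto)
  also have "\<dots> = (\<Sum>a=1..n. 2 ^ (n - a - 1) * 2 ^ (a - 2))"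
  proof (rule sum.cong[OF refl])
    fix a assume a: "a \<in> {1..n}"
    \<comment> \<open>The conditions from 132 in the rotation and from 213 in the permutation differ
      only for entries equal to \<open>a\<close>.\<close>
    have same: "sorted_wrt (\<lambda>y z. \<not> (y < a \<and> a \<le> z)) w \<longleftrightarrow> above_then_below a w"
      if "w \<in> permutations_of_set ({1..n} - {a})" for w
    proof -
      have "a \<notin> set w" using that by (auto simp: permutations_of_set_def)
      then show ?thesis
        by (intro sorted_wrt_set_cong) (auto simp: le_less)
    qed
    have "{w \<in> permutations_of_set ({1..n} - {a}).
        avoids_pattern (a # w) [2, 1, 3] \<and> avoids_pattern (rotate1 (a # w)) [1, 3, 2]}
      = {w \<in> Av ({1..n} - {a}). above_then_below a w}"
      using same by (auto simp: Av_def avoids_213_Cons avoids_132_snoc)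
    also have "card \<dots> = card (Av {x \<in> {1..n}. a < x} \<times> Av {x \<in> {1..n}. x < a})"
      using bij_betw_same_card[OF bij_betw_append_Av[OF a]] by simp
    also have "{x \<in> {1..n}. a < x} = {a<..n}"
      using a by auto
    also have "{x \<in> {1..n}. x < a} = {1..<a}"
      using a by auto
    finally show "card {w \<in> permutations_of_set ({1..n} - {a}).
        avoids_pattern (a # w) [2, 1, 3] \<and> avoids_pattern (rotate1 (a # w)) [1, 3, 2]}
      = 2 ^ (n - a - 1) * 2 ^ (a - 2)"
      by (simp add: card_cartesian_product card_Av numeral_2_eq_2)
  qed
  finally show ?thesis .
qed

section \<open>Evaluation of the sum\<close>

theorem proposition5p10:
  fixes n :: nat
  assumes "n \<ge> 2"
  shows "real (card (avoiders2 n [2, 1, 3] [1, 3, 2])) = (real n + 2) * 2 powi (int n - 3)"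
proof -
  obtain m where n: "n = m + 2" using assms by (metis add.commute le_Suc_ex)
  let ?t = "\<lambda>a. 2 ^ (n - a - 1) * 2 ^ (a - 2) :: nat"
  \<comment> \<open>At \<open>a = 1\<close> and \<open>a = n\<close> one block is empty and the term
    is \<open>2 ^ m\<close>, twice the value of an inner term.\<close>
  have ends: "(\<Sum>a=1..n. ?t a) = ?t 1 + ?t n + (\<Sum>a=2..m+1. ?t a)"
  proof -
    have "{1..n} = insert 1 (insert n {2..m+1})" using n by auto
    then show ?thesis using n by simp
  qed
  \<comment> \<open>Doubling avoids the exponent \<open>m - 1\<close>, which would be truncated at
    \<open>m = 0\<close>, where there are no inner terms.\<close>
  have "2 * (\<Sum>a=2..m+1. ?t a) = (\<Sum>a=2..m+1. 2 ^ m)"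
    unfolding sum_distrib_left
  proof (rule sum.cong[OF refl])
    fix a assume "a \<in> {2..m+1}"
    then have "Suc ((n - a - 1) + (a - 2)) = m" using n by auto
    then show "2 * ?t a = 2 ^ m" by (metis power_Suc power_add)
  qed
  then have "2 * card (avoiders2 n [2, 1, 3] [1, 3, 2]) = (m + 4) * 2 ^ m"
    using ends card_avoiders2[of n] n by (simp add: algebra_simps)
  then have twice: "2 * real (card (avoiders2 n [2, 1, 3] [1, 3, 2])) = (real m + 4) * 2 ^ m"
    by (metis of_nat_add of_nat_mult of_nat_numeral of_nat_power)
  \<comment> \<open>The exponent is \<open>int m - 1\<close>, which is negative for
    \<open>n = 2\<close>.\<close>
  have powi: "2 powi (int n - 3) = (2 ^ m / 2 :: real)"
    using power_int_diff[of "2::real" "int m" 1] n by simp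
  show ?thesis
    unfolding powi using twice n by (simp add: field_simps)
qed

end
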